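(* Let $n>1$ be an integer, let $\omega\in\mathbb{F}_{2^{2n}}\setminus\mathbb{F}_{2^n}$, and let $b\in\mathbb{F}_{2^{3n}}^*$ with $N_{2^{3n}/2^n}(b)\neq 1$ and such that $$x+bx^{2^{2n+1}-1}\notin\mathbb{F}_{2^n}\quad\text{for every } x\in\mathbb{F}_{2^{3n}}^*.$$ Then $$L_U=\{\langle x^2+bx^{2^{2n+1}}+x\omega\rangle_{\mathbb{F}_{2^{2n}}} : x\in\mathbb{F}_{2^{3n}}^*\},\qquad U=\{x^2+bx^{2^{2n+1}}+x\omega: x\in\mathbb{F}_{2^{3n}}\},$$ is a scattered $\mathbb{F}_2$-linear set of rank $3n$ of the projective plane $PG(2,2^{2n})=PG(\mathbb{F}_{2^{6n}},\mathbb{F}_{2^{2n}})$.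
   Context: $N_{2^{3n}/2^n}$ denotes the norm map from $\mathbb{F}_{2^{3n}}$ to $\mathbb{F}_{2^n}$. $\mathbb{F}_{2^{6n}}$ is regarded as a $3$-dimensional vector space over $\mathbb{F}_{2^{2n}}$. For an $\mathbb{F}_2$-subspace $U$ of $\mathbb{F}_{2^{6n}}$ of $\mathbb{F}_2$-dimension $k$, $L_U=\{\langle u\rangle_{\mathbb{F}_{2^{2n}}}: u\in U\setminus\{0\}\}$ is an $\mathbb{F}_2$-linear set of rank $k$; it is scattered if every point $\langle v\rangle$ of $L_U$ satisfies $\dim_{\mathbb{F}_2}(U\cap\langle v\rangle_{\mathbb{F}_{2^{2n}}})=1$. *)

theory Defs
  imports Complex_Main "HOL-Library.Z2" "HOL-Library.Cardinality"
begin

definition is_subfield :: "'a::field set \<Rightarrow> bool" where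
  "is_subfield K \<longleftrightarrow> 0 \<in> K \<and> 1 \<in> K \<and>
     (\<forall>x\<in>K. \<forall>y\<in>K. x - y \<in> K \<and> x * y \<in> K) \<and> (\<forall>x\<in>K. inverse x \<in> K)"

text \<open>The norm from the field with \<open>q ^ m\<close> elements to the field with \<open>q\<close> elements,
  as the product of the conjugates \<open>x ^ (q ^ i)\<close>, \<open>i < m\<close>.\<close>

definition norm_map :: "nat \<Rightarrow> nat \<Rightarrow> 'a::field \<Rightarrow> 'a" where
  "norm_map q m x = (\<Prod>i<m. x ^ (q ^ i))"

text \<open>The two-element field is the type \<^typ>\<open>bit\<close>. The following is its scalar multiplication on a
  field of characteristic 2.\<close>

definition f2_scale :: "bit \<Rightarrow> 'a::field \<Rightarrow> 'a" where
  "f2_scale c x = of_bit c * x"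

lemma vector_space_f2_scale:
  assumes "(1 :: 'a::field) + 1 = 0"
  shows "vector_space (f2_scale :: bit \<Rightarrow> 'a \<Rightarrow> 'a)"
proof
  fix a b :: bit and x y :: 'a
  have "x + x = (1 + 1) * x"
    by (simp only: distrib_right mult_1_left)
  then have xx: "x + x = 0"
    using assms by simp
  show "f2_scale a (x + y) = f2_scale a x + f2_scale a y"
    by (simp add: f2_scale_def distrib_left)
  show "f2_scale (a + b) x = f2_scale a x + f2_scale b x"
    using xx by (cases a; cases b) (simp_all add: f2_scale_def)
  show "f2_scale a (f2_scale b x) = f2_scale (a * b) x"
    by (cases a; cases b) (simp_all add: f2_scale_def)
  show "f2_scale 1 x = x"
    by (simp add: f2_scale_def)
qed

abbreviation f2_subspace :: "'a::field set \<Rightarrow> bool" where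
  "f2_subspace \<equiv> module.subspace f2_scale"

abbreviation f2_dim :: "'a::field set \<Rightarrow> nat" where
  "f2_dim \<equiv> vector_space.dim f2_scale"

text \<open>For a subfield \<open>K\<close>, the whole type is a vector space over \<open>K\<close>; the points of the associated
  projective space are the sets \<open>proj_point K v\<close> with \<open>v \<noteq> 0\<close>. If \<open>K\<close> has \<open>q\<close> elements and the type
  has \<open>q ^ 3\<close>, this is the projective plane PG(2,q).\<close>

definition proj_point :: "'a::field set \<Rightarrow> 'a \<Rightarrow> 'a set" where
  "proj_point K v = {c * v | c. c \<in> K}"

definition pg_points :: "'a::field set \<Rightarrow> 'a set set" where
  "pg_points K = {proj_point K v | v. v \<noteq> 0}"

definition linear_set :: "'a::field set \<Rightarrow> 'a set \<Rightarrow> 'a set set" where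
  "linear_set K U = {proj_point K u | u. u \<in> U - {0}}"

definition is_f2_linear_set :: "'a::field set \<Rightarrow> nat \<Rightarrow> 'a set \<Rightarrow> 'a set set \<Rightarrow> bool" where
  "is_f2_linear_set K k U L \<longleftrightarrow>
     f2_subspace U \<and> f2_dim U = k \<and> L = linear_set K U \<and> L \<subseteq> pg_points K"

definition is_scattered_f2_linear_set ::
    "'a::field set \<Rightarrow> nat \<Rightarrow> 'a set \<Rightarrow> 'a set set \<Rightarrow> bool" where
  "is_scattered_f2_linear_set K k U L \<longleftrightarrow>
     is_f2_linear_set K k U L \<and> (\<forall>P\<in>L. f2_dim (U \<inter> P) = 1)"

end

theory Submission
  imports Defs "HOL-Computational_Algebra.Polynomial"
begin

text \<open>Write \<open>q = 2 ^ n\<close> and \<open>f x = x ^ 2 + b * x ^ (2 * q ^ 2)\<close>. On \<open>F_3n\<close>, a space of dimension 3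
  over \<open>F_n\<close>, the map \<open>f\<close> is additive and satisfies \<open>f (t * x) = t ^ 2 * f x\<close> for \<open>t \<in> F_n\<close>; the
  hypothesis on \<open>b\<close> says that \<open>f\<close> has no eigenvector \<open>f z = l * z\<close> with \<open>l \<in> F_n\<close>.
  If \<open>f y + y * \<omega>\<close> is a multiple of \<open>f x + x * \<omega>\<close> by \<open>\<alpha> + \<beta> * \<omega>\<close> with \<open>\<alpha>, \<beta> \<in> F_n\<close> and
  \<open>\<beta> \<noteq> 0\<close>, then comparing coefficients shows that the plane \<open>W\<close> spanned by \<open>x\<close> and \<open>f x\<close> is
  \<open>f\<close>-invariant. An invariant plane forces an eigenvector: for \<open>v \<notin> W\<close> write \<open>f v = w + c * v\<close> with
  \<open>w \<in> W\<close>. If \<open>c = 0\<close>, then \<open>f\<close> maps into \<open>W\<close> and has a kernel. Otherwise rescale \<open>v\<close> to get \<open>c = 1\<close>;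
  if \<open>f\<close> has no fixed vector in \<open>W\<close>, then \<open>f + id\<close> is injective, hence surjective, on \<open>W\<close>, so that
  \<open>f u + u = w\<close> for some \<open>u \<in> W\<close> and \<open>v + u\<close> is fixed. Thus \<open>\<beta> = 0\<close>, and then \<open>\<alpha>\<close> is 0 or 1.\<close>

section \<open>Finite fields of characteristic two\<close>

text \<open>Translation by 1 permutes the field, so adding 1 to every summand leaves the sum of all
  elements unchanged.\<close>

lemma of_nat_CARD_eq_0: "of_nat CARD('a::{field,finite}) = (0::'a)"
proof -
  have "(\<Sum>y\<in>UNIV. y + 1) = (\<Sum>y\<in>UNIV. y :: 'a)"
    by (rule sum.reindex_bij_witness[of _ "\<lambda>y. y - 1" "\<lambda>y. y + 1"]) auto
  then show ?thesis
    by (simp add: sum.distrib)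
qed

lemma char_two_if_CARD_power_two:
  assumes "CARD('a::{field,finite}) = 2 ^ k"
  shows "(1::'a) + 1 = 0"
proof -
  have "(2::'a) ^ k = 0"
    using of_nat_CARD_eq_0[where 'a='a] assms by simp
  then show ?thesis
    by simp
qed

lemma char_two_uminus:
  assumes "(1::'a::field) + 1 = 0"
  shows "- x = (x::'a)"
proof -
  have "x + x = (1 + 1) * x"
    by (simp only: distrib_right mult_1_left)
  then show ?thesis
    using assms by (simp add: minus_unique)
qed

lemma frobenius_add:
  assumes "(1::'a::field) + 1 = 0"
  shows "(x + y) ^ (2 ^ k) = x ^ (2 ^ k) + (y::'a) ^ (2 ^ k)"
proof (induction k)
  case (Suc k)
  have two: "(2::'a) = 0"
    using assms by simp
  have "(x + y) ^ (2 ^ Suc k) = ((x + y) ^ (2 ^ k)) ^ 2"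
    by (simp add: power_mult[symmetric] mult.commute)
  also have "\<dots> = (x ^ (2 ^ k)) ^ 2 + (y ^ (2 ^ k)) ^ 2"
    by (simp add: Suc power2_sum two)
  finally show ?case
    by (simp add: power_mult[symmetric] mult.commute)
qed simp

lemma is_subfield_power:
  assumes "is_subfield K" "x \<in> K"
  shows "x ^ k \<in> K"
  using assms by (induction k) (auto simp: is_subfield_def)

lemma is_subfield_add:
  assumes "is_subfield K" "x \<in> K" "y \<in> K"
  shows "x + y \<in> K"
proof -
  have "0 - y \<in> K"
    using assms unfolding is_subfield_def by blast
  then have "x - (0 - y) \<in> K"
    using assms unfolding is_subfield_def by blast
  then show ?thesis
    by simp
qed

text \<open>Multiplication by a nonzero \<open>x\<close> permutes \<open>K - {0}\<close>; comparing
  the products over \<open>K - {0}\<close> gives \<open>x ^ (card K - 1) = 1\<close>.\<close>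

lemma is_subfield_power_card:
  fixes K :: "'a::{field,finite} set"
  assumes K: "is_subfield K" and x: "x \<in> K"
  shows "x ^ card K = x"
proof (cases "x = 0")
  case False
  have bij: "(\<Prod>y\<in>K - {0}. x * y) = \<Prod>(K - {0})"
    using K x False
    by (intro prod.reindex_bij_witness[of _ "\<lambda>y. inverse x * y" "\<lambda>y. x * y"])
      (auto simp: is_subfield_def)
  have "x ^ card (K - {0}) = 1"
    using bij by (simp add: prod.distrib)
  moreover have "card K = Suc (card (K - {0}))"
    using K card.remove[of K 0] by (simp add: is_subfield_def del: card_Diff_insert)
  ultimately show ?thesis
    by simp
next
  case True
  then have "card K > 0"
    using x by (auto simp: card_gt_0_iff)
  with True show ?thesis
    by (simp add: zero_power)
qed

text \<open>The polynomial X^(card K) - X has at most \<open>card K\<close> roots, and all of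
  \<open>K\<close> consists of roots. Hence a subfield is determined by its size.\<close>

lemma is_subfield_eq_fixed_points:
  fixes K :: "'a::{field,finite} set"
  assumes K: "is_subfield K"
  shows "K = {x. x ^ card K = x}"
proof (rule card_subset_eq)
  show sub: "K \<subseteq> {x. x ^ card K = x}"
    using is_subfield_power_card[OF K] by blast
  have "card {0, 1::'a} \<le> card K"
    using K by (intro card_mono) (auto simp: is_subfield_def)
  then have gt: "card K > 1"
    by simp
  define p :: "'a poly" where "p = monom 1 (card K) - monom 1 1"
  have "coeff p (card K) = 1"
    using gt by (simp add: p_def)
  then have nz: "p \<noteq> 0"
    by auto
  have "{x::'a. x ^ card K = x} = {x. poly p x = 0}"
    by (simp add: p_def poly_monom)
  then have "card {x::'a. x ^ card K = x} \<le> degree p"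
    using card_poly_roots_bound[OF nz] by simp
  also have "degree p \<le> card K"
    using gt unfolding p_def
    by (intro degree_diff_le) (simp_all add: degree_monom_eq)
  finally show "card K = card {x::'a. x ^ card K = x}"
    using card_mono[OF _ sub] by simp
qed simp

lemma power_power_fixed:
  assumes "x ^ r = (x::'a::monoid_mult)"
  shows "x ^ (r ^ k) = x"
  using assms by (induction k) (simp_all add: power_mult)

lemma is_subfield_subset_if_card_power:
  fixes K L :: "'a::{field,finite} set"
  assumes "is_subfield K" "is_subfield L" "card L = card K ^ k"
  shows "K \<subseteq> L"
proof
  fix x assume "x \<in> K"
  then have "x ^ card L = x"
    unfolding assms(3) by (intro power_power_fixed is_subfield_power_card[OF assms(1)])
  then show "x \<in> L"
    using is_subfield_eq_fixed_points[OF assms(2)] by blast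
qed

section \<open>Subspaces over a subfield\<close>

text \<open>Dimension over \<open>K\<close> is measured by counting: dimension d means
  \<open>card K ^ d\<close> elements, and \<open>adjoin\<close>, the sum W + Kv, raises d by one
  when \<open>v\<close> lies outside \<open>W\<close>.\<close>

definition subfield_subspace :: "'a::field set \<Rightarrow> 'a set \<Rightarrow> bool" where
  "subfield_subspace K W \<longleftrightarrow>
     0 \<in> W \<and> (\<forall>u\<in>W. \<forall>v\<in>W. u - v \<in> W) \<and> (\<forall>t\<in>K. \<forall>u\<in>W. t * u \<in> W)"

definition adjoin :: "'a::field set \<Rightarrow> 'a set \<Rightarrow> 'a \<Rightarrow> 'a set" where
  "adjoin K W v = (\<lambda>(w, t). w + t * v) ` (W \<times> K)"

lemma adjoinI: "w \<in> W \<Longrightarrow> t \<in> K \<Longrightarrow> w + t * v \<in> adjoin K W v"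
  by (auto simp: adjoin_def)

lemma adjoinE:
  assumes "z \<in> adjoin K W v"
  obtains w t where "w \<in> W" "t \<in> K" "z = w + t * v"
  using assms by (auto simp: adjoin_def)

lemma subfield_subspace_of_subfield:
  assumes "is_subfield L" "K \<subseteq> L"
  shows "subfield_subspace K L"
  using assms by (auto simp: subfield_subspace_def is_subfield_def)

lemma subfield_subspace_add:
  assumes "subfield_subspace K W" "u \<in> W" "v \<in> W"
  shows "u + v \<in> W"
proof -
  have "0 - v \<in> W"
    using assms unfolding subfield_subspace_def by blast
  then have "u - (0 - v) \<in> W"
    using assms unfolding subfield_subspace_def by blast
  then show ?thesis
    by simp
qed

lemma subfield_subspace_adjoin:
  assumes K: "is_subfield K" and W: "subfield_subspace K W"
  shows "subfield_subspace K (adjoin K W v)"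
  unfolding subfield_subspace_def
proof (intro conjI ballI)
  show "0 \<in> adjoin K W v"
    using adjoinI[of 0 W 0 K v] K W by (simp add: is_subfield_def subfield_subspace_def)
next
  fix u u' assume "u \<in> adjoin K W v" "u' \<in> adjoin K W v"
  then obtain w t w' t' where *: "w \<in> W" "t \<in> K" "u = w + t * v"
      "w' \<in> W" "t' \<in> K" "u' = w' + t' * v"
    by (metis adjoinE)
  have "u - u' = (w - w') + (t - t') * v"
    by (simp add: * algebra_simps)
  moreover have "w - w' \<in> W" "t - t' \<in> K"
    using * K W by (simp_all add: is_subfield_def subfield_subspace_def)
  ultimately show "u - u' \<in> adjoin K W v"
    by (simp only: adjoinI)
next
  fix s u assume s: "s \<in> K" and "u \<in> adjoin K W v"
  then obtain w t where *: "w \<in> W" "t \<in> K" "u = w + t * v"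
    by (metis adjoinE)
  have "s * u = s * w + (s * t) * v"
    by (simp add: * algebra_simps)
  moreover have "s * w \<in> W" "s * t \<in> K"
    using * s K W by (simp_all add: is_subfield_def subfield_subspace_def)
  ultimately show "s * u \<in> adjoin K W v"
    by (simp only: adjoinI)
qed

text \<open>If the coefficients of \<open>v\<close> differed, dividing by their difference would put
  \<open>v\<close> into \<open>W\<close>.\<close>

lemma adjoin_decomposition_unique:
  assumes K: "is_subfield K" and W: "subfield_subspace K W" and v: "v \<notin> W"
    and "w \<in> W" "w' \<in> W" "t \<in> K" "t' \<in> K" and eq: "w + t * v = w' + t' * v"
  shows "w = w' \<and> t = t'"
proof (rule ccontr)
  assume "\<not> ?thesis"
  with eq have ne: "t - t' \<noteq> 0"
    by auto
  have "inverse (t - t') * (w' - w) \<in> W"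
    using assms by (simp add: is_subfield_def subfield_subspace_def)
  moreover have "inverse (t - t') * (w' - w) = v"
    using ne eq by (simp add: field_simps)
  ultimately show False
    using v by simp
qed

lemma card_adjoin:
  assumes "is_subfield K" "subfield_subspace K W" "v \<notin> W"
  shows "card (adjoin K W v) = card W * card K"
proof -
  have "inj_on (\<lambda>(w, t). w + t * v) (W \<times> K)"
    using adjoin_decomposition_unique[OF assms] by (auto simp: inj_on_def)
  then show ?thesis
    by (simp add: adjoin_def card_image card_cartesian_product)
qed

lemma adjoin_subset:
  assumes "subfield_subspace K V" "W \<subseteq> V" "v \<in> V"
  shows "adjoin K W v \<subseteq> V"
proof
  fix z assume "z \<in> adjoin K W v"
  then obtain w t where "w \<in> W" "t \<in> K" "z = w + t * v"
    by (metis adjoinE)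
  moreover from this have "t * v \<in> V"
    using assms by (auto simp: subfield_subspace_def)
  ultimately show "z \<in> V"
    using assms subfield_subspace_add by blast
qed

section \<open>Frobenius-semilinear maps with an invariant plane\<close>

lemma semilinear_invariant_plane_eigenvector:
  fixes K V :: "'a::{field,finite} set" and f :: "'a \<Rightarrow> 'a"
  assumes char2: "(1::'a) + 1 = 0" and K: "is_subfield K"
    and V: "subfield_subspace K V" and cardV: "card V = card K ^ 3"
    and add: "\<And>u v. f (u + v) = f u + f v"
    and semi: "\<And>t v. t \<in> K \<Longrightarrow> f (t * v) = t\<^sup>2 * f v"
    and fV: "\<And>v. v \<in> V \<Longrightarrow> f v \<in> V"
    and x: "x \<in> V" "x \<noteq> 0"
    and ffx: "P \<in> K" "Q \<in> K" "f (f x) = Q * x + P * f x"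
  shows "\<exists>z\<in>V - {0}. \<exists>l\<in>K. f z = l * z"
proof (rule ccontr)
  assume "\<not> ?thesis"
  then have no_eig: "f z \<noteq> l * z" if "z \<in> V" "z \<noteq> 0" "l \<in> K" for z l
    using that by auto
  have K01: "0 \<in> K" "1 \<in> K"
    using K by (auto simp: is_subfield_def)
  have minus: "u - v = u + v" for u v :: 'a
    using char_two_uminus[OF char2, of v] by (metis diff_conv_add_uminus)
  define A where "A = adjoin K {0} x"
  define W where "W = adjoin K A (f x)"
  have zero: "subfield_subspace K {0::'a}"
    by (simp add: subfield_subspace_def)
  have A: "subfield_subspace K A"
    unfolding A_def by (rule subfield_subspace_adjoin[OF K zero])
  have W: "subfield_subspace K W"
    unfolding W_def by (rule subfield_subspace_adjoin[OF K A])
  have A_iff: "u \<in> A \<longleftrightarrow> (\<exists>t\<in>K. u = t * x)" for u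
    by (force simp: A_def adjoin_def)
  \<comment> \<open>Otherwise \<open>x\<close> itself would be an eigenvector. So \<open>W\<close>
    is a genuine plane.\<close>
  have fxA: "f x \<notin> A"
    using no_eig[OF x] by (auto simp: A_iff)
  have "card A = card K"
    unfolding A_def using card_adjoin[OF K zero, of x] x by simp
  then have cardW: "card W = card K ^ 2"
    unfolding W_def using card_adjoin[OF K A fxA] by (simp add: power2_eq_square)
  have AV: "A \<subseteq> V"
    unfolding A_def using V x by (intro adjoin_subset) (auto simp: subfield_subspace_def)
  have WV: "W \<subseteq> V"
    unfolding W_def using AV V fV[OF x(1)] by (intro adjoin_subset)
  have memW: "s * x + t * f x \<in> W" if "s \<in> K" "t \<in> K" for s t
    unfolding W_def using that by (intro adjoinI) (auto simp: A_iff)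
  have fW: "f w \<in> W" if w: "w \<in> W" for w
  proof -
    obtain s t where st: "s \<in> K" "t \<in> K" and "w = s * x + t * f x"
      using w unfolding W_def by (metis adjoinE A_iff)
    then have "f w = s\<^sup>2 * f x + t\<^sup>2 * f (f x)"
      by (simp add: add semi)
    also have "\<dots> = (t\<^sup>2 * Q) * x + (s\<^sup>2 + t\<^sup>2 * P) * f x"
      by (simp add: ffx algebra_simps)
    finally show ?thesis
      using st ffx K is_subfield_power[OF K] is_subfield_add[OF K]
      by (auto intro!: memW simp: is_subfield_def)
  qed
  have "card {0, 1::'a} \<le> card K"
    using K01 by (intro card_mono) auto
  then have lt: "card W < card V"
    by (simp add: cardW cardV power_strict_increasing)
  then obtain v where v: "v \<in> V" "v \<notin> W"
    using WV by (metis order.irrefl subsetI subset_antisym)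
  have AdjV: "adjoin K W v = V"
    using adjoin_subset[OF V WV v(1)] card_adjoin[OF K W v(2)]
    by (intro card_subset_eq) (simp_all add: cardV cardW power3_eq_cube power2_eq_square)
  then obtain w c where wc: "w \<in> W" "c \<in> K" "f v = w + c * v"
    using fV[OF v(1)] by (metis adjoinE)
  show False
  proof (cases "c = 0")
    case True
    \<comment> \<open>Here \<open>f v = w\<close> lies in \<open>W\<close>, so \<open>f\<close>
      squeezes \<open>V\<close> into a smaller set; a collision yields an eigenvector with
      \<open>l = 0\<close>.\<close>
    have "f ` V \<subseteq> W"
    proof
      fix z assume "z \<in> f ` V"
      then obtain u t where ut: "u \<in> W" "t \<in> K" "z = f (u + t * v)"
        using AdjV by (metis adjoinE imageE)
      then have "z = f u + t\<^sup>2 * w"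
        using True wc by (simp add: add semi)
      moreover have "t\<^sup>2 * w \<in> W"
        using W wc ut is_subfield_power[OF K] by (auto simp: subfield_subspace_def)
      ultimately show "z \<in> W"
        using fW ut W subfield_subspace_add by blast
    qed
    then have "\<not> inj_on f V"
      using lt card_image[of f V] card_mono[of W "f ` V"] by fastforce
    then obtain u u' where u: "u \<in> V" "u' \<in> V" "u \<noteq> u'" "f u = f u'"
      by (auto simp: inj_on_def)
    then have "f (u - u') = 0"
      using minus add by (metis cancel_comm_monoid_add_class.diff_cancel)
    moreover have "u - u' \<in> V"
      using u V by (auto simp: subfield_subspace_def)
    ultimately show False
      using no_eig[of "u - u'" 0] u K01 by simp
  next
    case False
    \<comment> \<open>Because \<open>f\<close> squares scalars, replacing \<open>v\<close> by
      \<open>d * v\<close> multiplies the coefficient \<open>c\<close> by \<open>d\<close>, which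
      normalises it to 1.\<close>
    define d where "d = inverse c"
    have d: "d \<in> K" "d\<^sup>2 \<in> K" "d \<noteq> 0" "d * c = 1"
      using wc K False is_subfield_power[OF K, of d 2] by (auto simp: d_def is_subfield_def)
    have fdv: "f (d * v) = d\<^sup>2 * w + d * v"
    proof -
      have "f (d * v) = d\<^sup>2 * w + (d * c) * (d * v)"
        using d wc by (simp add: semi algebra_simps power2_eq_square)
      then show ?thesis
        by (simp add: d)
    qed
    define g where "g = (\<lambda>u. f u + u)"
    have gW: "g ` W \<subseteq> W"
      using fW W subfield_subspace_add by (fastforce simp: g_def)
    \<comment> \<open>In characteristic 2, a collision of \<open>g\<close> yields a nonzero vector
      fixed by \<open>f\<close>, excluded by \<open>l = 1\<close>.\<close>
    have "inj_on g W"
    proof (rule inj_onI, rule ccontr)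
      fix u u' assume u: "u \<in> W" "u' \<in> W" "g u = g u'" "u \<noteq> u'"
      have "f (u - u') + (u - u') = g u - g u'"
        by (simp add: g_def minus add)
      then have "f (u - u') = 1 * (u - u')"
        using u minus by (metis diff_self eq_iff_diff_eq_0 mult_1)
      moreover have "u - u' \<in> V"
        using u W WV by (auto simp: subfield_subspace_def)
      ultimately show False
        using no_eig[of "u - u'" 1] u K01 by simp
    qed
    then have "g ` W = W"
      using gW by (simp add: endo_inj_surj)
    moreover have "d\<^sup>2 * w \<in> W"
      using W wc d by (auto simp: subfield_subspace_def)
    ultimately have "d\<^sup>2 * w \<in> g ` W"
      by simp
    then obtain u where u: "u \<in> W" "f u + u = d\<^sup>2 * w"
      by (auto simp: g_def)
    have "f (d * v + u) = (f u + u) + d * v + f u"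
      by (simp add: add fdv u)
    also have "\<dots> = (f u + f u) + (d * v + u)"
      by (simp add: algebra_simps)
    also have "f u + f u = 0"
      using minus[of "f u" "f u"] by simp
    finally have "f (d * v + u) = 1 * (d * v + u)"
      by simp
    moreover have "d * v \<in> V"
      using V d v by (auto simp: subfield_subspace_def)
    then have "d * v + u \<in> V"
      using V u WV subfield_subspace_add by blast
    moreover have "d * v + u \<noteq> 0"
    proof
      assume "d * v + u = 0"
      then have "u = d * v"
        using minus[of "d * v" u] by (metis eq_iff_diff_eq_0)
      then have "c * u = v"
        using d by (simp add: mult.assoc[symmetric] mult.commute)
      moreover have "c * u \<in> W"
        using W wc u by (auto simp: subfield_subspace_def)
      ultimately show False
        using v by simp
    qed
    ultimately show False
      using no_eig K01 by blast
  qed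
qed

section \<open>Dimension over the two-element field\<close>

lemma f2_subspaceI:
  assumes char2: "(1::'a::field) + 1 = 0" and "0 \<in> S" "\<And>u v. u \<in> S \<Longrightarrow> v \<in> S \<Longrightarrow> u + v \<in> S"
  shows "f2_subspace (S :: 'a set)"
proof -
  interpret vector_space "f2_scale :: bit \<Rightarrow> 'a \<Rightarrow> 'a"
    by (rule vector_space_f2_scale[OF char2])
  have "f2_scale c u \<in> S" if "u \<in> S" for c u
    using that assms by (cases c) (simp_all add: f2_scale_def)
  then show ?thesis
    using assms by (simp add: subspace_def)
qed

text \<open>Each new basis vector \<open>a\<close> doubles the span: it becomes the disjoint union
  of the old span and its translate by \<open>a\<close>.\<close>

lemma card_f2_subspace:
  fixes S :: "'a::{field,finite} set"
  assumes char2: "(1::'a) + 1 = 0" and S: "f2_subspace S"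
  shows "card S = 2 ^ f2_dim S"
proof -
  interpret vector_space "f2_scale :: bit \<Rightarrow> 'a \<Rightarrow> 'a"
    by (rule vector_space_f2_scale[OF char2])
  have card_span: "card (span B) = 2 ^ card B" if "independent B" for B
    using finite[of B] that
  proof (induction B rule: finite_induct)
    case (insert a B)
    then have ind: "independent B" "a \<notin> span B"
      by (simp_all add: independent_insert)
    have "span (insert a B) = span B \<union> (\<lambda>u. u + a) ` span B"
    proof -
      have "z \<in> span (insert a B) \<longleftrightarrow> z \<in> span B \<or> z - a \<in> span B" for z
      proof -
        have "(\<exists>k. R k) \<longleftrightarrow> R 0 \<or> R 1" for R :: "bit \<Rightarrow> bool"
          by (metis (full_types) bit.exhaust)
        then show ?thesis
          unfolding span_insert mem_Collect_eq by simp
      qed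
      moreover have "z - a \<in> span B \<longleftrightarrow> z \<in> (\<lambda>u. u + a) ` span B" for z
        using image_iff[of z "\<lambda>u. u + a" "span B"] by (metis add_diff_cancel_right' diff_add_cancel)
      ultimately show ?thesis
        by blast
    qed
    moreover have "span B \<inter> (\<lambda>u. u + a) ` span B = {}"
    proof (rule ccontr)
      assume "\<not> ?thesis"
      then obtain u where "u \<in> span B" "u + a \<in> span B"
        by blast
      then have "(u + a) - u \<in> span B"
        by (intro span_diff)
      then show False
        using ind(2) by simp
    qed
    moreover have "card ((\<lambda>u. u + a) ` span B) = card (span B)"
      by (simp add: card_image)
    ultimately show ?case
      using insert ind by (simp add: card_Un_disjoint)
  qed simp
  obtain B where B: "B \<subseteq> S" "independent B" "S \<subseteq> span B" "card B = dim S"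
    using basis_exists by blast
  then have "span B = S"
    using S span_minimal by blast
  with card_span[OF B(2)] B show ?thesis
    by simp
qed

lemma f2_dim_eqI:
  fixes S :: "'a::{field,finite} set"
  assumes "(1::'a) + 1 = 0" "f2_subspace S" "card S = 2 ^ k"
  shows "f2_dim S = k"
  using card_f2_subspace[OF assms(1,2)] assms(3) by simp

section \<open>The scattered linear set\<close>

theorem theorem2p10:
  fixes n :: nat
    and F_n F_2n F_3n :: "'a::{field,finite} set"
    and \<omega> b :: 'a
  assumes "n > 1"
    and "CARD('a) = 2 ^ (6 * n)"
    and "is_subfield F_n" and "card F_n = 2 ^ n"
    and "is_subfield F_2n" and "card F_2n = 2 ^ (2 * n)"
    and "is_subfield F_3n" and "card F_3n = 2 ^ (3 * n)"
    and "\<omega> \<in> F_2n - F_n"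
    and "b \<in> F_3n - {0}"
    and "norm_map (2 ^ n) 3 b \<noteq> 1"
    and "\<forall>x\<in>F_3n - {0}. x + b * x ^ (2 ^ (2 * n + 1) - 1) \<notin> F_n"
  shows "is_scattered_f2_linear_set F_2n (3 * n)
           {x ^ 2 + b * x ^ (2 ^ (2 * n + 1)) + x * \<omega> | x. x \<in> F_3n}
           {proj_point F_2n (x ^ 2 + b * x ^ (2 ^ (2 * n + 1)) + x * \<omega>) | x. x \<in> F_3n - {0}}"
proof -

  \<comment> \<open>The tower of subfields and coordinates with respect to 1 and \<omega>\<close>
  have char2: "(1::'a) + 1 = 0"
    by (rule char_two_if_CARD_power_two[OF assms(2)])
  have minus: "u - v = u + v" for u v :: 'a
    using char_two_uminus[OF char2, of v] by (metis diff_conv_add_uminus)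
  have card2: "card F_2n = card F_n ^ 2" and card3: "card F_3n = card F_n ^ 3"
    by (simp_all add: assms(4,6,8) power_mult[symmetric] mult.commute)
  have F12: "F_n \<subseteq> F_2n" and F13: "F_n \<subseteq> F_3n"
    using is_subfield_subset_if_card_power assms(3,5,7) card2 card3 by blast+
  have sub11: "subfield_subspace F_n F_n" and sub12: "subfield_subspace F_n F_2n"
    and sub13: "subfield_subspace F_n F_3n" and sub33: "subfield_subspace F_3n F_3n"
    using F12 F13 assms(3,5,7) by (auto intro: subfield_subspace_of_subfield)
  have F2: "F_2n = adjoin F_n F_n \<omega>"
    using adjoin_subset[OF sub12 F12, of \<omega>] card_adjoin[OF assms(3) sub11, of \<omega>] assms(9)
    by (intro card_subset_eq[symmetric]) (simp_all add: card2 power2_eq_square)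
  \<comment> \<open>With q = \<open>card F_n\<close>, being fixed by the powers q^2 and q^3 forces
    being fixed by the power q, so \<open>F_2n\<close> and \<open>F_3n\<close> meet in
    \<open>F_n\<close>.\<close>
  have \<omega>3: "\<omega> \<notin> F_3n"
  proof
    assume "\<omega> \<in> F_3n"
    then have "\<omega> ^ (card F_n ^ 3) = \<omega>"
      using is_subfield_power_card[OF assms(7)] card3 by simp
    moreover have "\<omega> ^ (card F_n ^ 2) = \<omega>"
      using is_subfield_power_card[OF assms(5)] assms(9) card2 by simp
    then have "\<omega> ^ (card F_n ^ 3) = \<omega> ^ card F_n"
      by (simp add: power3_eq_cube power2_eq_square power_mult)
    ultimately show False
      using is_subfield_eq_fixed_points[OF assms(3)] assms(9) by auto
  qed
  have unique: "u = u' \<and> t = t'"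
    if "u + t * \<omega> = u' + t' * \<omega>" "u \<in> F_3n" "t \<in> F_3n" "u' \<in> F_3n" "t' \<in> F_3n" for u t u' t'
    using adjoin_decomposition_unique[OF assms(7) sub33 \<omega>3] that by blast

  \<comment> \<open>The semilinear map \<open>f\<close> and its lack of eigenvectors\<close>
  define f where "f = (\<lambda>x. x\<^sup>2 + b * x ^ (2 ^ (2 * n + 1)))"
  have f_add: "f (u + v) = f u + f v" for u v
  proof -
    have "(u + v)\<^sup>2 = u\<^sup>2 + v\<^sup>2"
      using frobenius_add[OF char2, of u v 1] by (simp only: power_one_right)
    then show ?thesis
      unfolding f_def by (simp only: frobenius_add[OF char2] distrib_left add_ac)
  qed
  have f_semi: "f (t * v) = t\<^sup>2 * f v" if "t \<in> F_n" for t v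
  proof -
    have "t ^ (card F_n ^ 2) = t"
      using is_subfield_power_card[OF assms(3) that] power_power_fixed by blast
    \<comment> \<open>The exponent is twice \<open>card F_n ^ 2\<close>, so on \<open>F_n\<close>
      this power is just squaring.\<close>
    moreover have "t ^ (2 ^ (2 * n + 1)) = (t ^ (2 ^ (2 * n)))\<^sup>2"
      by (simp add: power_mult[symmetric] mult.commute)
    ultimately have "t ^ (2 ^ (2 * n + 1)) = t\<^sup>2"
      by (simp only: card2[symmetric] assms(6))
    then show ?thesis
      by (simp add: f_def power_mult_distrib algebra_simps)
  qed
  have f_mem: "f v \<in> F_3n" if "v \<in> F_3n" for v
  proof -
    have "b * v ^ (2 ^ (2 * n + 1)) \<in> F_3n"
      using assms(7,10) is_subfield_power[OF assms(7) that] unfolding is_subfield_def by blast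
    then show ?thesis
      unfolding f_def
      by (intro is_subfield_add[OF assms(7)] is_subfield_power[OF assms(7) that])
  qed
  \<comment> \<open>Dividing \<open>f z = l * z\<close> by \<open>z\<close> gives exactly the
    expression that the hypothesis keeps out of \<open>F_n\<close>.\<close>
  have no_eig: "f z \<noteq> l * z" if "z \<in> F_3n - {0}" "l \<in> F_n" for z l
  proof
    assume eq: "f z = l * z"
    have "z ^ (2 ^ (2 * n + 1)) = z ^ (2 ^ (2 * n + 1) - 1) * z"
      by (rule power_minus_mult[symmetric]) simp
    then have "f z = (z + b * z ^ (2 ^ (2 * n + 1) - 1)) * z"
      by (simp add: f_def power2_eq_square algebra_simps)
    with eq that have "z + b * z ^ (2 ^ (2 * n + 1) - 1) = l"
      by simp
    with that assms(12) show False
      by blast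
  qed

  \<comment> \<open>The parametrization \<open>h\<close> of the linear set\<close>
  define h where "h = (\<lambda>x. f x + x * \<omega>)"
  have h_add: "h (u + v) = h u + h v" for u v
    by (simp add: h_def f_add algebra_simps)
  have h_inj: "u = v" if "h u = h v" "u \<in> F_3n" "v \<in> F_3n" for u v
    using unique[of "f u" u "f v" v] that f_mem by (simp add: h_def)
  have F3_0: "0 \<in> F_3n"
    using assms(7) by (simp add: is_subfield_def)
  have h0: "h 0 = 0"
    by (simp add: h_def f_def)
  have h_eq_0: "h u = 0 \<longleftrightarrow> u = 0" if "u \<in> F_3n" for u
    using h_inj[of u 0] that h0 F3_0 by auto

  \<comment> \<open>Proportional values of \<open>h\<close>\<close>
  have collinear: "y = 0 \<or> y = x"
    if x: "x \<in> F_3n - {0}" and y: "y \<in> F_3n" and c: "c \<in> F_2n" and eq: "h y = c * h x" for x y c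
  proof -
    obtain \<alpha> \<beta> where ab: "\<alpha> \<in> F_n" "\<beta> \<in> F_n" "c = \<alpha> + \<beta> * \<omega>"
      using c F2 by (metis adjoinE)
    have "\<omega> * \<omega> \<in> F_2n"
      using assms(5,9) by (simp add: is_subfield_def)
    \<comment> \<open>This is the quadratic equation of \<omega> over \<open>F_n\<close>; it reduces
      the product \<open>c * h x\<close> to coordinates with respect to 1 and \<omega>.\<close>
    then obtain N T where NT: "N \<in> F_n" "T \<in> F_n" "\<omega> * \<omega> = N + T * \<omega>"
      using F2 by (metis adjoinE)
    note mem = is_subfield_add[OF assms(7)] is_subfield_add[OF assms(3)]
      is_subfield_power[OF assms(3)]
    have mult3: "u * v \<in> F_3n" if "u \<in> F_3n" "v \<in> F_3n" for u v
      using assms(7) that by (simp add: is_subfield_def)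
    have mult1: "u * v \<in> F_n" if "u \<in> F_n" "v \<in> F_n" for u v
      using assms(3) that by (simp add: is_subfield_def)
    have inv1: "inverse u \<in> F_n" if "u \<in> F_n" for u
      using assms(3) that by (simp add: is_subfield_def)
    have "f y + y * \<omega> = \<alpha> * f x + (\<alpha> * x + \<beta> * f x) * \<omega> + \<beta> * x * (\<omega> * \<omega>)"
      using eq by (simp add: h_def ab algebra_simps)
    also have "\<dots> = (\<alpha> * f x + \<beta> * N * x) + ((\<alpha> + \<beta> * T) * x + \<beta> * f x) * \<omega>"
      by (simp add: NT algebra_simps)
    finally have fy: "f y = \<alpha> * f x + \<beta> * N * x \<and> y = (\<alpha> + \<beta> * T) * x + \<beta> * f x"
      using x y ab NT F13 f_mem by (intro unique) (auto intro!: mem mult3)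
    show ?thesis
    proof (cases "\<beta> = 0")
      case True
      \<comment> \<open>Now \<open>y = \<alpha> * x\<close>, so \<open>f y\<close> is both
        \<open>\<alpha>\<^sup>2 * f x\<close> by semilinearity and \<open>\<alpha> * f x\<close> by
        comparison of coefficients.\<close>
      then have "\<alpha>\<^sup>2 * f x = \<alpha> * f x"
        using fy f_semi[OF ab(1), of x] by auto
      moreover have "f x \<noteq> 0"
        using no_eig[OF x, of 0] assms(3) by (simp add: is_subfield_def)
      ultimately have "\<alpha> = 0 \<or> \<alpha> = 1"
        by (simp add: power2_eq_square)
      then show ?thesis
        using fy True by auto
    next
      case False
      define A where "A = \<alpha> + \<beta> * T"
      have A: "A \<in> F_n"
        unfolding A_def using ab NT by (intro mem mult1)
      \<comment> \<open>Applying \<open>f\<close> to the formula for \<open>y\<close> and equating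
        with the formula for \<open>f y\<close> solves for \<open>f (f x)\<close> in terms of
        \<open>x\<close> and \<open>f x\<close>.\<close>
      have "f y = A\<^sup>2 * f x + \<beta>\<^sup>2 * f (f x)"
        using fy A ab by (simp add: A_def[symmetric] f_add f_semi)
      then have "\<beta>\<^sup>2 * f (f x) = f y - A\<^sup>2 * f x"
        by (simp only: add_diff_cancel_left')
      also have "\<dots> = f y + A\<^sup>2 * f x"
        by (rule minus)
      also have "\<dots> = \<beta> * N * x + (\<alpha> + A\<^sup>2) * f x"
        unfolding fy[THEN conjunct1] by (simp add: algebra_simps)
      finally have "\<beta>\<^sup>2 * f (f x) = \<beta> * N * x + (\<alpha> + A\<^sup>2) * f x" .
      then have "f (f x) = (inverse \<beta> * N) * x + ((\<alpha> + A\<^sup>2) * (inverse \<beta>)\<^sup>2) * f x"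
        using False by (simp add: field_simps power2_eq_square)
      moreover have "inverse \<beta> * N \<in> F_n" "(\<alpha> + A\<^sup>2) * (inverse \<beta>)\<^sup>2 \<in> F_n"
        using ab NT A by (auto intro!: mem mult1 inv1)
      ultimately have "\<exists>z\<in>F_3n - {0}. \<exists>l\<in>F_n. f z = l * z"
        using semilinear_invariant_plane_eigenvector[OF char2 assms(3) sub13 card3 f_add f_semi f_mem]
          x by blast
      then show ?thesis
        using no_eig by blast
    qed
  qed

  \<comment> \<open>Rank and scatteredness\<close>
  define U where "U = h ` F_3n"
  have U_sub: "f2_subspace U"
  proof (rule f2_subspaceI[OF char2])
    show "0 \<in> U"
      unfolding U_def using h0 F3_0 by (metis imageI)
    show "u + v \<in> U" if "u \<in> U" "v \<in> U" for u v
      using that is_subfield_add[OF assms(7)] by (auto simp: U_def h_add[symmetric])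
  qed
  \<comment> \<open>Injectivity of \<open>h\<close> on \<open>F_3n\<close> gives the rank by
    counting.\<close>
  have "card U = 2 ^ (3 * n)"
    unfolding U_def using h_inj assms(8) by (subst card_image) (auto simp: inj_on_def)
  then have U_dim: "f2_dim U = 3 * n"
    by (rule f2_dim_eqI[OF char2 U_sub])
  define L where "L = {proj_point F_2n (h x) | x. x \<in> F_3n - {0}}"
  have L: "L = linear_set F_2n U"
    unfolding L_def linear_set_def U_def using h_eq_0 by blast
  have L_pg: "L \<subseteq> pg_points F_2n"
    unfolding L_def pg_points_def using h_eq_0 by blast
  have scattered: "f2_dim (U \<inter> M) = 1" if "M \<in> L" for M
  proof -
    obtain x where x: "x \<in> F_3n - {0}" "M = proj_point F_2n (h x)"
      using \<open>M \<in> L\<close> by (auto simp: L_def)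
    have hx: "h x \<noteq> 0"
      using x h_eq_0 by simp
    have F2_01: "0 \<in> F_2n" "1 \<in> F_2n"
      using assms(5) by (simp_all add: is_subfield_def)
    have "0 \<in> M" "h x \<in> M"
      unfolding x(2) proj_point_def using F2_01 by force+
    moreover have "0 \<in> U" "h x \<in> U"
      unfolding U_def using F3_0 h0 x by (force, simp)
    moreover have "v = 0 \<or> v = h x" if "v \<in> U" "v \<in> M" for v
      using that collinear[OF x(1)] h0 unfolding U_def x(2) proj_point_def by blast
    \<comment> \<open>Two elements over the two-element field mean dimension 1.\<close>
    ultimately have UM: "U \<inter> M = {0, h x}"
      by auto
    have "h x + h x = 0"
      using minus[of "h x" "h x"] by simp
    then have "f2_subspace (U \<inter> M)"
      unfolding UM by (intro f2_subspaceI[OF char2]) auto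
    moreover have "card (U \<inter> M) = 2 ^ 1"
      using hx by (simp add: UM)
    ultimately show ?thesis
      by (rule f2_dim_eqI[OF char2])
  qed
  have "is_scattered_f2_linear_set F_2n (3 * n) U L"
    using U_sub U_dim L L_pg scattered
    by (simp add: is_scattered_f2_linear_set_def is_f2_linear_set_def)
  moreover have "U = {x ^ 2 + b * x ^ (2 ^ (2 * n + 1)) + x * \<omega> | x. x \<in> F_3n}"
    by (auto simp: U_def h_def f_def)
  ultimately show ?thesis
    by (simp add: L_def h_def f_def)
qed

end
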